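(* There are infinitely many pairs $(n,X)$ of positive integers with $n\geq 3$ such that the $n$-tuple $(1,\ldots,1,2,X,X)$ (with $n-3$ ones) satisfies $\sigma_2=\sigma_n$ and $2\leq X$. In particular, $$\liminf_{n\to+\infty}\ \min_{(x_1,\ldots,x_n)\in S(n)}\frac{x_n}{x_{n-1}}=1,$$ where $S(n)$ is the set of $n$-tuples $(x_1,\ldots,x_n)$ of positive integers with $x_1\leq\cdots\leq x_n$ and $\sigma_2(x_1,\ldots,x_n)=\sigma_n(x_1,\ldots,x_n)$.
   Context: $\sigma_k$ denotes the $k$-th elementary symmetric polynomial in $n$ variables. *)

theory Defs
  imports "HOL-Analysis.Analysis"
begin

text \<open>
  A tuple \<open>(x\<^sub>1, \<dots>, x\<^sub>n)\<close> is a list of length \<open>n\<close>; because list indices start at 0,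
  \<open>x\<^sub>i\<close> is \<open>xs ! (i - 1)\<close>.
\<close>

definition esym :: "nat \<Rightarrow> 'a::comm_semiring_1 list \<Rightarrow> 'a" where
  "esym k xs = (\<Sum>I | I \<subseteq> {..<length xs} \<and> card I = k. \<Prod>i\<in>I. xs ! i)"

definition S :: "nat \<Rightarrow> nat list set" where
  "S n = {xs. length xs = n \<and> (\<forall>x\<in>set xs. 0 < x) \<and> sorted xs \<and> esym 2 xs = esym n xs}"

text \<open>
  The minimum over \<open>S n\<close> is formed with \<^const>\<open>Min\<close>, which is only meaningful on finite
  nonempty sets. The rest of this theory shows that \<open>S n\<close> is finite and nonempty for all
  \<open>n \<ge> 3\<close>.
\<close>

lemma esym_length: "esym (length xs) xs = (\<Prod>i<length xs. xs ! i)"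
proof -
  have "{I. I \<subseteq> {..<length xs} \<and> card I = length xs} = {{..<length xs}}"
    using card_subset_eq[of "{..<length xs}"] by auto
  then show ?thesis by (simp add: esym_def)
qed

lemma esym_0: "esym 0 xs = 1"
proof -
  have "{I. I \<subseteq> {..<length xs} \<and> card I = 0} = {{}}"
    using finite_subset[of _ "{..<length xs}"] by (auto simp: card_eq_0_iff)
  then show ?thesis by (simp add: esym_def)
qed

lemma esym_Suc_Nil: "esym (Suc k) [] = 0"
proof -
  have "{I. I \<subseteq> {..<length []} \<and> card I = Suc k} = {}" by auto
  then show ?thesis unfolding esym_def by (metis sum.empty)
qed

lemma esym_Cons: "esym (Suc k) (x # xs) = x * esym k xs + esym (Suc k) xs"
proof -
  let ?n = "length xs"
  let ?P = "\<lambda>j. {I. I \<subseteq> {..<?n} \<and> card I = j}"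
  let ?A = "(\<lambda>I. insert 0 (Suc ` I)) ` ?P k" and ?B = "(\<lambda>I. Suc ` I) ` ?P (Suc k)"
  let ?f = "\<lambda>I. \<Prod>i\<in>I. (x # xs) ! i"
  have fin: "finite I" if "I \<in> ?P j" for I j
    using that finite_subset[of I "{..<?n}"] by auto
  have finP: "finite (?P j)" for j by simp
  have split: "{I. I \<subseteq> {..<length (x # xs)} \<and> card I = Suc k} = ?A \<union> ?B"
  proof (intro equalityI subsetI)
    fix I assume "I \<in> {I. I \<subseteq> {..<length (x # xs)} \<and> card I = Suc k}"
    then have I: "I \<subseteq> {..<Suc ?n}" "card I = Suc k" and finI: "finite I"
      using finite_subset[of I "{..<Suc ?n}"] by auto
    define J where "J = {i. Suc i \<in> I}"
    have J: "Suc ` J = I - {0}"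
      unfolding J_def image_def by (auto simp: gr0_conv_Suc)
    have cJ: "card J = card (I - {0})"
      using card_image[of Suc J] J by simp
    have subJ: "J \<subseteq> {..<?n}" using I(1) by (auto simp: J_def)
    show "I \<in> ?A \<union> ?B"
    proof (cases "0 \<in> I")
      case True
      then have "I = insert 0 (Suc ` J)" "card J = k" using J cJ I(2) finI by auto
      then show ?thesis using subJ by blast
    next
      case False
      then have "I = Suc ` J" "card J = Suc k" using J cJ I(2) by auto
      then show ?thesis using subJ by blast
    qed
  next
    fix I assume "I \<in> ?A \<union> ?B"
    then show "I \<in> {I. I \<subseteq> {..<length (x # xs)} \<and> card I = Suc k}"
    proof
      assume "I \<in> ?A"
      then obtain J where J: "J \<in> ?P k" "I = insert 0 (Suc ` J)" by blast
      have "finite J" using fin J(1) .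
      then have "card I = Suc (card (Suc ` J))" unfolding J(2) by (intro card_insert_disjoint) auto
      then have "card I = Suc k" using J(1) by (simp add: card_image)
      moreover have "I \<subseteq> {..<Suc ?n}" using J by auto
      ultimately show ?thesis by simp
    next
      assume "I \<in> ?B"
      then obtain J where "J \<in> ?P (Suc k)" "I = Suc ` J" by blast
      then show ?thesis by (auto simp: card_image)
    qed
  qed
  have injA: "inj_on (\<lambda>I. insert 0 (Suc ` I)) (?P k)"
  proof (rule inj_onI)
    fix I J :: "nat set" assume "insert 0 (Suc ` I) = insert 0 (Suc ` J)"
    then have "Suc ` I = Suc ` J" by (metis Diff_insert_absorb imageE old.nat.distinct(1))
    then show "I = J" by (simp add: inj_image_eq_iff)
  qed
  have injB: "inj_on (\<lambda>I. Suc ` I) (?P (Suc k))"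
    by (rule inj_onI) (simp add: inj_image_eq_iff)
  have "esym (Suc k) (x # xs) = sum ?f (?A \<union> ?B)"
    unfolding esym_def split ..
  also have "\<dots> = sum ?f ?A + sum ?f ?B"
    by (rule sum.union_disjoint) (use finP in auto)
  also have "sum ?f ?A = (\<Sum>I\<in>?P k. x * (\<Prod>i\<in>I. xs ! i))"
    unfolding sum.reindex[OF injA] o_def
  proof (intro sum.cong refl)
    fix I assume "I \<in> ?P k"
    then have "finite I" by (rule fin)
    then have "?f (insert 0 (Suc ` I)) = x * ?f (Suc ` I)" by (subst prod.insert) auto
    then show "?f (insert 0 (Suc ` I)) = x * (\<Prod>i\<in>I. xs ! i)" by (simp add: prod.reindex)
  qed
  also have "\<dots> = x * esym k xs" by (simp add: esym_def sum_distrib_left)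
  also have "sum ?f ?B = esym (Suc k) xs"
    unfolding sum.reindex[OF injB] o_def esym_def
    by (intro sum.cong refl) (auto simp: prod.reindex)
  finally show ?thesis .
qed

lemma esym_1: "esym (Suc 0) xs = sum_list xs"
  by (induction xs) (simp_all add: esym_Suc_Nil esym_Cons esym_0)

lemma esym_2_replicate:
  "2 * esym 2 (replicate k (1::nat) @ ys) + k = k * k + 2 * k * sum_list ys + 2 * esym 2 ys"
proof (induction k)
  case (Suc k)
  have "esym 2 (replicate (Suc k) (1::nat) @ ys) =
      k + sum_list ys + esym 2 (replicate k 1 @ ys)"
    by (simp add: numeral_2_eq_2 esym_Cons esym_1 sum_list_replicate)
  then show ?case using Suc by (simp add: algebra_simps)
qed simp

lemma esym_2_three: "esym 2 [a, b, c] = a * b + a * c + b * (c::nat)"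
proof -
  have "esym (Suc (Suc 0)) [a, b, c] = a * b + a * c + b * c"
    by (simp add: esym_Cons esym_0 esym_Suc_Nil algebra_simps)
  then show ?thesis by (simp add: numeral_2_eq_2)
qed

lemma esym_all: "length xs = n \<Longrightarrow> esym n xs = prod_list xs"
  by (metis esym_length prod.list_conv_set_nth atLeast0LessThan)

lemma S_nonempty:
  assumes "n \<ge> 3"
  shows "S n \<noteq> {}"
proof -
  obtain k where n: "n = k + 3" using assms by (metis le_add_diff_inverse2)
  define c where "c = (k * k + 3 * k) div 2"
  have "even (k * k + 3 * k)" by simp
  then have c: "2 * c = k * k + 3 * k" by (simp add: c_def)
  define y where "y = (k + 2) + (k + 2) * (k + 2) + c"
  let ?xs = "replicate k 1 @ [2, k + 3, y]"
  have "2 * esym 2 ?xs + k = k * k + 2 * k * (2 + (k + 3) + y) + 2 * (2 * (k + 3) + 2 * y + (k + 3) * y)"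
    unfolding esym_2_replicate by (simp add: esym_2_three)
  then have "2 * esym 2 ?xs = 3 * (k * k) + 13 * k + 12 + 10 * y + 4 * (k * y)"
    by (simp add: algebra_simps)
  moreover have "2 * y = 3 * (k * k) + 13 * k + 12"
    using c by (simp add: y_def algebra_simps)
  moreover have "prod_list ?xs = 2 * (k * y) + 6 * y"
    by (simp add: algebra_simps)
  ultimately have "esym 2 ?xs = prod_list ?xs" by linarith
  then have "esym 2 ?xs = esym n ?xs"
    using esym_all[of ?xs n] n by simp
  moreover have "sorted ?xs" by (auto simp: sorted_append y_def)
  moreover have "y > 0" by (simp add: y_def)
  ultimately have "?xs \<in> S n" by (auto simp: S_def n)
  then show ?thesis by blast
qed

lemma S_finite:
  assumes n: "n \<ge> 3"
  shows "finite (S n)"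
proof -
  define K where "K = n choose 2"
  define B where "B = K * K"
  define C where "C = K * (B * B)"
  let ?F = "{I. I \<subseteq> {..<n} \<and> card I = 2}"
  have finF: "finite ?F" by simp
  have cardF: "card ?F = K" using n_subsets[of "{..<n}" 2] by (simp add: K_def)
  have "xs \<in> {xs. set xs \<subseteq> {..C} \<and> length xs = n}" if xs: "xs \<in> S n" for xs
  proof -
    let ?x = "\<lambda>i. xs ! i" and ?f = "\<lambda>I. \<Prod>i\<in>I. xs ! i"
    define a where "a = ?x (n - 1)"
    define b where "b = ?x (n - 2)"
    define P where "P = (\<Prod>i<n-2. ?x i)"
    have len: "length xs = n" and sym: "esym 2 xs = esym n xs"
      using xs by (auto simp: S_def)
    have pos: "?x i > 0" if "i < n" for i using xs that by (auto simp: S_def)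
    have mono: "?x i \<le> ?x j" if "i \<le> j" "j < n" for i j
      using xs that by (auto simp: S_def sorted_iff_nth_mono)
    have e2: "esym 2 xs = sum ?f ?F" using len by (simp add: esym_def)
    have en: "esym n xs = P * b * a"
    proof -
      define m where "m = n - 2"
      have m: "n = Suc (Suc m)" using n by (simp add: m_def)
      show ?thesis using esym_length[of xs] len
        by (simp add: m P_def a_def b_def)
    qed
    have eq: "P * b * a = sum ?f ?F" using sym e2 en by simp
    have pair: "\<exists>i j. i < j \<and> j < n \<and> I = {i, j} \<and> ?f I = ?x i * ?x j" if "I \<in> ?F" for I
    proof -
      have "card I = 2" using that by simp
      then obtain i j where "I = {i, j}" "i \<noteq> j" unfolding card_2_iff by blast
      then obtain i j where "I = {i, j}" "i < j" by (metis insert_commute linorder_neqE_nat)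
      then show ?thesis using that by (intro exI[of _ i] exI[of _ j]) auto
    qed
    have apos: "a > 0" and bpos: "b > 0" using pos n by (auto simp: a_def b_def)
    have "sum ?f ?F \<le> of_nat (card ?F) * (b * a)"
    proof (rule sum_bounded_above)
      fix I assume "I \<in> ?F"
      then obtain i j where "i < j" "j < n" "?f I = ?x i * ?x j" using pair by blast
      then show "?f I \<le> b * a"
        using mono[of i "n - 2"] mono[of j "n - 1"] n by (auto simp: a_def b_def intro!: mult_mono)
    qed
    then have "P * (b * a) \<le> K * (b * a)" using eq cardF by (simp add: mult.assoc)
    then have PK: "P \<le> K" using apos bpos by simp
    have small: "?x i \<le> K" if "i < n - 2" for i
    proof -
      have "?x i dvd P" unfolding P_def using that by (intro dvd_prodI) auto
      moreover have "P > 0" unfolding P_def using pos by (intro prod_pos) auto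
      ultimately show ?thesis using PK dvd_imp_le order_trans by blast
    qed
    let ?T = "{n - 2, n - 1}"
    have T: "?T \<in> ?F" and fT: "?f ?T = b * a" using n by (auto simp: a_def b_def)
    have R: "sum ?f ?F = b * a + sum ?f (?F - {?T})"
      using sum.remove[OF finF T, of ?f] fT by simp
    have "sum ?f (?F - {?T}) \<le> of_nat (card (?F - {?T})) * (K * a)"
    proof (rule sum_bounded_above)
      fix I assume I: "I \<in> ?F - {?T}"
      then obtain i j where ij: "i < j" "j < n" "I = {i, j}" "?f I = ?x i * ?x j"
        using pair by blast
      have "i < n - 2"
      proof (rule ccontr)
        assume "\<not> i < n - 2"
        then have "i = n - 2" "j = n - 1" using ij by auto
        then show False using I ij(3) by simp
      qed
      then show "?f I \<le> K * a"
        using small[of i] mono[of j "n - 1"] ij by (auto simp: a_def intro!: mult_mono)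
    qed
    also have "\<dots> \<le> K * (K * a)"
      using card_mono[OF finF, of "?F - {?T}"] cardF by (intro mult_right_mono) auto
    finally have Rle: "sum ?f (?F - {?T}) \<le> B * a" by (simp add: B_def mult.assoc)
    have nonneg: "?f I > 0" if "I \<in> ?F" for I using that pos by (intro prod_pos) auto
    have T0: "{0, 1} \<in> ?F" using n by auto
    have "{0, 1} \<noteq> ?T" using n by (auto simp: doubleton_eq_iff)
    then have "{0, 1} \<in> ?F - {?T}" using T0 by (intro DiffI) simp_all
    then have ne: "?F - {?T} \<noteq> {}" by (intro notI) (simp only: empty_iff)
    have "sum ?f (?F - {?T}) > 0"
    proof (rule sum_pos)
      show "?f I > 0" if "I \<in> ?F - {?T}" for I using that by (intro nonneg) (rule DiffD1)
      show "finite (?F - {?T})" using finF by (rule finite_Diff)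
    qed (rule ne)
    then have "P * (b * a) > 1 * (b * a)" using eq R by (simp add: mult.assoc)
    then have P2: "P \<ge> 2" by (metis mult_less_cancel2 Suc_leI Suc_1)
    have "2 * (b * a) \<le> P * (b * a)" using P2 by (rule mult_le_mono1)
    moreover have "P * (b * a) \<le> b * a + B * a" using eq R Rle by (simp only: mult.assoc)
    ultimately have "b * a \<le> B * a" by linarith
    then have bB: "b \<le> B" using apos by simp
    let ?G = "{I \<in> ?F. n - 1 \<notin> I}" and ?H = "{I \<in> ?F. n - 1 \<in> I}"
    have GH: "sum ?f ?F = sum ?f ?H + sum ?f ?G"
      using sum.Int_Diff[OF finF, of ?f "{I. n - 1 \<in> I}"]
      by (simp add: Int_def set_diff_eq conj_ac)
    have "a dvd sum ?f ?H"
    proof (rule dvd_sum)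
      fix I assume "I \<in> ?H"
      then have "n - 1 \<in> I" "finite I" using finite_subset[of I "{..<n}"] by auto
      then show "a dvd ?f I" unfolding a_def by (rule dvd_prodI[rotated])
    qed
    moreover have "a dvd sum ?f ?F" by (simp add: eq[symmetric])
    ultimately have "a dvd sum ?f ?G" using GH by (simp add: dvd_add_right_iff)
    moreover have "sum ?f ?G > 0"
    proof (rule sum_pos)
      have "n - 1 \<notin> {0, 1}" using n by auto
      then have "{0, 1} \<in> ?G" using T0 by simp
      then show "?G \<noteq> {}" by (intro notI) (simp only: empty_iff)
      show "?f I > 0" if "I \<in> ?G" for I using nonneg[of I] that by simp
      show "finite ?G" using finF by simp
    qed
    ultimately have "a \<le> sum ?f ?G" by (rule dvd_imp_le)
    also have "\<dots> \<le> of_nat (card ?G) * (B * B)"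
    proof (rule sum_bounded_above)
      fix I assume I: "I \<in> ?G"
      then obtain i j where ij: "i < j" "j < n" "I = {i, j}" "?f I = ?x i * ?x j"
        using pair by blast
      have "j \<noteq> n - 1" using I ij(3) by auto
      then have "?x i \<le> b" "?x j \<le> b"
        using mono[of i "n - 2"] mono[of j "n - 2"] ij n by (auto simp: b_def)
      then show "?f I \<le> B * B"
        unfolding ij(4) using bB by (intro mult_mono) auto
    qed
    also have "\<dots> \<le> K * (B * B)"
      using card_mono[OF finF, of ?G] cardF by (intro mult_right_mono) auto
    finally have aC: "a \<le> C" by (simp add: C_def)
    have "?x i \<le> C" if "i < n" for i
    proof -
      have "i \<le> n - 1" "n - 1 < n" using that by auto
      then have "?x i \<le> a" unfolding a_def by (rule mono)
      then show ?thesis using aC by simp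
    qed
    then show ?thesis using len by (auto simp: in_set_conv_nth)
  qed
  then have "S n \<subseteq> {xs. set xs \<subseteq> {..C} \<and> length xs = n}" by blast
  then show ?thesis by (rule finite_subset) (simp add: finite_lists_length_eq)
qed

end

theory Submission
  imports Defs
begin

text \<open>
  For \<open>n = k + 3\<close> the equation \<open>\<sigma>\<^sub>2 = \<sigma>\<^sub>n\<close> on \<open>(1, \<dots>, 1, 2, X, X)\<close> is a quadratic in \<open>X\<close>.
  Completing squares with \<open>W = 6k + 11\<close> and \<open>Z = X - k - 2\<close> turns it into the Pell-type equation
  \<open>W\<^sup>2 - 24 Z\<^sup>2 = 25\<close>. Multiplication by the unit \<open>49 + 10 \<surd>24\<close> preserves its solutions and the
  residue of \<open>W\<close> modulo 6, so the solution \<open>(k, X) = (0, 4)\<close> generates infinitely many. Along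
  the corresponding \<open>n\<close> the two largest entries agree, so the minimal ratio is 1 there, and it is
  at least 1 everywhere.
\<close>

abbreviation two_X_X :: "nat \<Rightarrow> nat \<Rightarrow> nat list" where
  "two_X_X k X \<equiv> replicate k 1 @ [2, X, X]"

text \<open>Both sides are doubled, so that the pairs of ones contribute \<open>k * (k - 1)\<close>
  without division; one \<open>2 * (X * X)\<close> then cancels.\<close>

lemma esym_2_eq_esym_all_iff:
  "esym 2 (two_X_X k X) = esym (k + 3) (two_X_X k X) \<longleftrightarrow>
     2 * (X * X) = k * k + 3 * k + 4 * (k * X) + 8 * X"
proof -
  have "2 * esym 2 (two_X_X k X) + k = k * k + 2 * k * (2 + X + X) + 2 * (2 * X + 2 * X + X * X)"
    unfolding esym_2_replicate by (simp add: esym_2_three)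
  then have "2 * esym 2 (two_X_X k X) = k * k + 3 * k + 4 * (k * X) + 8 * X + 2 * (X * X)"
    by (simp add: algebra_simps)
  moreover have "esym (k + 3) (two_X_X k X) = 2 * (X * X)"
    using esym_all[of "two_X_X k X" "k + 3"] by simp
  ultimately show ?thesis by linarith
qed

text \<open>Multiplication by \<open>49 + 10 \<surd>24\<close> in the coordinates \<open>(k, X)\<close>.\<close>

fun pell_step :: "nat \<times> nat \<Rightarrow> nat \<times> nat" where
  "pell_step (k, X) = (9 * k + 40 * X + 8, 20 * k + 89 * X + 22)"

definition sol :: "nat \<Rightarrow> nat \<times> nat" where
  "sol i = (pell_step ^^ i) (0, 4)"

lemma sol_Suc: "sol (Suc i) = pell_step (sol i)"
  by (simp add: sol_def)

lemma sol_eq: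
  assumes "sol i = (k, X)"
  shows "2 * (X * X) = k * k + 3 * k + 4 * (k * X) + 8 * X" and "X \<ge> 2"
  using assms
proof (induction i arbitrary: k X)
  case 0
  { case 1 then show ?case by (auto simp: sol_def) }
  { case 2 then show ?case by (auto simp: sol_def) }
next
  case (Suc i)
  obtain k' X' where s: "sol i = (k', X')" by fastforce
  { case 1
    then have "k = 9 * k' + 40 * X' + 8" "X = 20 * k' + 89 * X' + 22"
      by (simp_all add: sol_Suc s)
    \<comment> \<open>The unit has norm \<open>49^2 - 24 * 10^2 = 1\<close>, so right minus left
      side is the same polynomial value at \<open>(k, X)\<close> as at
      \<open>(k', X')\<close>.\<close>
    with Suc(1)[OF s] show ?case by (simp add: algebra_simps) }
  { case 2 then show ?case by (auto simp: sol_Suc s) }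
qed

text \<open>Serves twice: it provides the subsequence for the limit inferior and makes the solutions
  pairwise distinct.\<close>

lemma strict_mono_sol: "strict_mono (\<lambda>i. fst (sol i) + 3)"
proof (rule strict_monoI_Suc)
  fix i
  obtain k X where "sol i = (k, X)" by fastforce
  then show "fst (sol i) + 3 < fst (sol (Suc i)) + 3" by (simp add: sol_Suc)
qed

lemma two_X_X_sol_in_S:
  assumes "sol i = (k, X)"
  shows "two_X_X k X \<in> S (k + 3)"
proof -
  have "esym 2 (two_X_X k X) = esym (k + 3) (two_X_X k X)"
    using sol_eq(1)[OF assms] by (simp only: esym_2_eq_esym_all_iff)
  moreover have "sorted (two_X_X k X)" "\<forall>x\<in>set (two_X_X k X). 0 < x"
    using sol_eq(2)[OF assms] by (auto simp: sorted_append)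
  ultimately show ?thesis unfolding S_def by simp
qed

definition min_ratio :: "nat \<Rightarrow> real" where
  "min_ratio n = Min ((\<lambda>xs. real (xs ! (n - 1)) / real (xs ! (n - 2))) ` S n)"

lemma min_ratio_ge_1:
  assumes "n \<ge> 3"
  shows "min_ratio n \<ge> 1"
proof -
  have "1 \<le> real (xs ! (n - 1)) / real (xs ! (n - 2))" if "xs \<in> S n" for xs
  proof -
    have "xs ! (n - 2) > 0" "xs ! (n - 2) \<le> xs ! (n - 1)"
      using that assms by (auto simp: S_def sorted_iff_nth_mono)
    then show ?thesis by simp
  qed
  then show ?thesis
    using S_finite[OF assms] S_nonempty[OF assms] by (auto simp: min_ratio_def)
qed

lemma min_ratio_sol: "min_ratio (fst (sol i) + 3) = 1"
proof (rule antisym)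
  obtain k X where s: "sol i = (k, X)" by fastforce
  \<comment> \<open>Indices start at 0, so these are the last two of the \<open>k + 3\<close>
    entries.\<close>
  have "two_X_X k X ! (k + 2) = X" "two_X_X k X ! (k + 1) = X"
    by (simp_all add: nth_append)
  then have "real (two_X_X k X ! (k + 3 - 1)) / real (two_X_X k X ! (k + 3 - 2)) = 1"
    using sol_eq(2)[OF s] by simp
  then have "1 \<in> (\<lambda>xs. real (xs ! (k + 3 - 1)) / real (xs ! (k + 3 - 2))) ` S (k + 3)"
    using two_X_X_sol_in_S[OF s] by (intro image_eqI) (rule sym)
  then show "min_ratio (fst (sol i) + 3) \<le> 1"
    unfolding min_ratio_def s fst_conv by (intro Min_le finite_imageI S_finite) auto
qed (simp add: min_ratio_ge_1)

lemma liminf_min_ratio: "liminf (\<lambda>n. ereal (min_ratio n)) = 1"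
proof (rule antisym)
  \<comment> \<open>Passing to a subsequence can only raise the limit inferior.\<close>
  have "liminf (\<lambda>n. ereal (min_ratio n)) \<le> liminf ((\<lambda>n. ereal (min_ratio n)) \<circ> (\<lambda>i. fst (sol i) + 3))"
    by (rule liminf_subseq_mono) (rule strict_mono_sol)
  also have "\<dots> = 1"
    by (simp add: o_def min_ratio_sol Liminf_const flip: one_ereal_def)
  finally show "liminf (\<lambda>n. ereal (min_ratio n)) \<le> 1" .
  \<comment> \<open>The lower bound is known from \<open>n = 3\<close> on, which suffices
    eventually.\<close>
  show "1 \<le> liminf (\<lambda>n. ereal (min_ratio n))"
    by (rule Liminf_bounded)
      (auto simp: eventually_sequentially min_ratio_ge_1 intro!: exI[of _ 3])
qed

theorem theorem3p4:
  shows "infinite {(n::nat, X::nat). n \<ge> 3 \<and> X \<ge> 2 \<and>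
           esym 2 (replicate (n - 3) 1 @ [2, X, X]) = esym n (replicate (n - 3) 1 @ [2, X, X])}
    \<and> liminf (\<lambda>n. ereal (Min ((\<lambda>xs. real (xs ! (n - 1)) / real (xs ! (n - 2))) ` S n))) = 1"
    (is "infinite ?A \<and> _")
proof
  have "range (\<lambda>i. (fst (sol i) + 3, snd (sol i))) \<subseteq> ?A"
  proof clarify
    fix i
    obtain k X where s: "sol i = (k, X)" by fastforce
    show "3 \<le> fst (sol i) + 3 \<and> 2 \<le> snd (sol i) \<and>
        esym 2 (two_X_X (fst (sol i) + 3 - 3) (snd (sol i))) =
        esym (fst (sol i) + 3) (two_X_X (fst (sol i) + 3 - 3) (snd (sol i)))"
      using sol_eq[OF s] esym_2_eq_esym_all_iff[of k X] by (simp add: s)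
  qed
  moreover have "inj (\<lambda>i. (fst (sol i) + 3, snd (sol i)))"
    using strict_mono_imp_inj_on[OF strict_mono_sol] by (auto simp: inj_on_def)
  ultimately show "infinite ?A"
    using range_inj_infinite infinite_super by blast
  show "liminf (\<lambda>n. ereal (Min ((\<lambda>xs. real (xs ! (n - 1)) / real (xs ! (n - 2))) ` S n))) = 1"
    using liminf_min_ratio by (simp only: min_ratio_def)
qed

end
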